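(* Let $X$ be a Banach space and $\mathcal{K}$ a compact subset of $X$. Assume that there are constants $C_0,C_1>0$ and real numbers $\mu,s$ with $0\le\mu\le\frac12$ and $s>\mu$ such that $$d_n(\mathcal{K})_X\le C_0\max(1,n)^{-s}\quad\text{for all } n\ge 0,\qquad\text{and}\qquad \gamma_n(X)\le C_1 n^{\mu}\quad\text{for all } n\ge 1 .$$ Then $$\sigma_n(\mathcal{K})_X\le C_0\,C_1\,2^{\mu}\,16^{s}\,\sqrt{\log_2(2n)}\;n^{-s+\mu}\qquad\text{for all } n\ge 2 .$$
   Context: Greedy algorithm: for a (nonempty) compact set $\mathcal{K}$ in a Banach space $X$, choose $f_0\in\mathcal{K}$ with $\|f_0\|_X=\max_{f\in\mathcal{K}}\|f\|_X$; having chosen $f_0,\dots,f_{n-1}$, put $V_n=\operatorname{span}\{f_0,\dots,f_{n-1}\}$ and choose $f_n\in\mathcal{K}$ with $\operatorname{dist}(f_n,V_n)_X=\max_{f\in\mathcal{K}}\operatorname{dist}(f,V_n)_X$, where $\operatorname{dist}(f,V)_X=\inf_{g\in V}\|f-g\|_X$. Set $\sigma_0(\mathcal{K})_X=\|f_0\|_X$ and $\sigma_n(\mathcal{K})_X=\operatorname{dist}(f_n,V_n)_X$ for $n\ge1$. The sequences $(f_n)$ and $(\sigma_n(\mathcal{K})_X)$ need not be unique; the statement concerns any sequence produced by this algorithm. Kolmogorov widths: $d_0(\mathcal{K})_X=\max_{f\in\mathcal{K}}\|f\|_X$ and, for $n\ge 1$, $d_n(\mathcal{K})_X=\inf_L\sup_{f\in\mathcal{K}}\operatorname{dist}(f,L)_X$,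 the infimum over all $n$-dimensional subspaces $L$ of $X$ (if $\dim X<n$, over subspaces of dimension at most $n$). Banach–Mazur distance: for isomorphic Banach spaces $Y,Z$, $d(Y,Z)=\inf\{\|T\|\,\|T^{-1}\| : T:Y\to Z \text{ an isomorphism}\}$. For $n\ge1$, $\gamma_n(X)=\sup\{d(V,\ell_2^n): V \text{ an } n\text{-dimensional subspace of } X\}$ (the supremum of the empty set being $0$). *)

theory Defs
  imports "HOL-Analysis.Analysis" "HOL-Analysis.Finite_Function_Topology"
begin

definition subspaces_of_dim :: "nat \<Rightarrow> 'a::real_vector set set" where
  \<comment> \<open>Finite dimension is required explicitly because \<^const>\<open>dim\<close> is 0 on infinite-dimensional spaces.\<close>
  "subspaces_of_dim n = {L. subspace L \<and> (\<exists>B. finite B \<and> L = span B) \<and> dim L = n}"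

definition kolmogorov_subspaces :: "nat \<Rightarrow> 'a::real_vector set set" where
  "kolmogorov_subspaces n =
     (if (subspaces_of_dim n :: 'a set set) \<noteq> {} then subspaces_of_dim n
      else (\<Union>m\<le>n. subspaces_of_dim m))"

definition kolmogorov_width :: "'a::real_normed_vector set \<Rightarrow> nat \<Rightarrow> real" where
  "kolmogorov_width K n =
     (if n = 0 then (SUP f\<in>K. norm f)
      else (INF L\<in>kolmogorov_subspaces n. SUP f\<in>K. infdist f L))"

definition greedy_space :: "(nat \<Rightarrow> 'a::real_vector) \<Rightarrow> nat \<Rightarrow> 'a set" where
  "greedy_space f n = span (f ` {..<n})"

definition greedy_sequence :: "'a::real_normed_vector set \<Rightarrow> (nat \<Rightarrow> 'a) \<Rightarrow> bool" where
  "greedy_sequence K f \<longleftrightarrow>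
     (\<forall>n. f n \<in> K) \<and>
     (\<forall>g\<in>K. norm g \<le> norm (f 0)) \<and>
     (\<forall>n\<ge>1. \<forall>g\<in>K. infdist g (greedy_space f n) \<le> infdist (f n) (greedy_space f n))"

definition greedy_error :: "(nat \<Rightarrow> 'a::real_normed_vector) \<Rightarrow> nat \<Rightarrow> real" where
  "greedy_error f n = (if n = 0 then norm (f 0) else infdist (f n) (greedy_space f n))"

text \<open>
  In the following, a normed space is given by a linear subspace of some real vector space
  together with a norm function on it.  The norm is an explicit argument, since the spaces
  \<open>\<ell>\<^sub>2\<^sup>n\<close> for varying \<open>n\<close> are realised below inside a type whose type class norm is not
  the Euclidean one.
\<close>

definition op_norm_on ::
  "'a::real_vector set \<Rightarrow> ('a \<Rightarrow> real) \<Rightarrow> ('b::real_vector \<Rightarrow> real) \<Rightarrow> ('a \<Rightarrow> 'b) \<Rightarrow> real" where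
  \<comment> \<open>The argument \<open>0\<close> contributes \<open>0 / 0 = 0\<close>.\<close>
  "op_norm_on V normV normW T = (SUP x\<in>V. normW (T x) / normV x)"

definition isomorphism_on ::
  "'a::real_vector set \<Rightarrow> ('a \<Rightarrow> real) \<Rightarrow> 'b::real_vector set \<Rightarrow> ('b \<Rightarrow> real) \<Rightarrow> ('a \<Rightarrow> 'b) \<Rightarrow> bool" where
  "isomorphism_on V normV W normW T \<longleftrightarrow>
     bij_betw T V W \<and>
     (\<forall>x\<in>V. \<forall>y\<in>V. T (x + y) = T x + T y) \<and>
     (\<forall>c. \<forall>x\<in>V. T (c *\<^sub>R x) = c *\<^sub>R T x) \<and>
     (\<exists>B. \<forall>x\<in>V. normW (T x) \<le> B * normV x) \<and>
     (\<exists>B. \<forall>y\<in>W. normV (inv_into V T y) \<le> B * normW y)"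

definition banach_mazur ::
  "'a::real_vector set \<Rightarrow> ('a \<Rightarrow> real) \<Rightarrow> 'b::real_vector set \<Rightarrow> ('b \<Rightarrow> real) \<Rightarrow> ennreal" where
  \<comment> \<open>The value is \<open>\<infinity>\<close> for non-isomorphic spaces.\<close>
  "banach_mazur V normV W normW =
     (INF T\<in>{T. isomorphism_on V normV W normW T}.
        ennreal (op_norm_on V normV normW T * op_norm_on W normW normV (inv_into V T)))"

definition l2_space :: "nat \<Rightarrow> (nat \<Rightarrow>\<^sub>0 real) set" where
  "l2_space n = {x. Poly_Mapping.keys x \<subseteq> {..<n}}"

definition l2_norm :: "(nat \<Rightarrow>\<^sub>0 real) \<Rightarrow> real" where
  "l2_norm x = L2_set (Poly_Mapping.lookup x) (Poly_Mapping.keys x)"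

definition bm_gamma :: "'a::real_normed_vector itself \<Rightarrow> nat \<Rightarrow> ennreal" where
  \<comment> \<open>In \<^typ>\<open>ennreal\<close> the supremum of the empty set is \<open>0\<close>.\<close>
  "bm_gamma _ n = (SUP V\<in>(subspaces_of_dim n :: 'a set set). banach_mazur V norm (l2_space n) l2_norm)"

end

theory Submission
  imports Defs "Jordan_Normal_Form.Determinant"
begin

text \<open>
  Suppose \<open>\<sigma>\<^sub>n > 0\<close>, let \<open>2\<^sup>a \<le> n < 2\<^sup>a\<^sup>+\<^sup>1\<close>, and let \<open>L\<^sub>k\<close> be nearly optimal for the width of order \<open>2\<^sup>k\<close>, for \<open>k < a\<close>.
  The span of \<open>f\<^sub>0, \<dots>, f\<^sub>n\<^sub>-\<^sub>1\<close> and all the \<open>L\<^sub>k\<close> has dimension below \<open>2n\<close>, so it carries a Euclidean norm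
  that is at least the given norm and at most \<open>\<gamma>\<close> times it, with \<open>\<gamma>\<close> close to \<open>C\<^sub>1 (2n)\<^sup>\<mu>\<close>.
  Project everything onto the span of the \<open>f\<^sub>i\<close>. In an orthonormal basis adapted to the \<open>f\<^sub>i\<close> their coordinate matrix is
  triangular, and its diagonal dominates \<open>\<sigma>\<^sub>0, \<dots>, \<sigma>\<^sub>n\<^sub>-\<^sub>1\<close>. In an orthonormal basis adapted to the flag
  \<open>L\<^sub>0 \<subseteq> L\<^sub>0 + L\<^sub>1 \<subseteq> \<dots>\<close> the columns split into \<open>a + 1\<close> dyadic blocks; dividing block \<open>k\<close> by the
  corresponding bound on the width makes each row contribute at most \<open>\<gamma>\<^sup>2\<close> per block. Hadamard's inequality
  then bounds \<open>\<sigma>\<^sub>0 \<cdots> \<sigma>\<^sub>n\<^sub>-\<^sub>1\<close> by \<open>(\<gamma> sqrt (a + 1))\<^sup>n\<close> times the product of the scaling factors, and the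
  latter is at most \<open>(C\<^sub>0 4\<^sup>s)\<^sup>n (n!)\<^sup>-\<^sup>s\<close>, up to the slack in the \<open>L\<^sub>k\<close>. Since \<open>\<sigma>\<close> is nonincreasing, taking \<open>n\<close>-th roots gives the claim.
\<close>

section \<open>Orthonormal systems and triangularization in coordinates\<close>

definition orthonormal_cols :: "nat \<Rightarrow> (nat \<Rightarrow> nat \<Rightarrow> real) \<Rightarrow> bool" where
  "orthonormal_cols n Q \<longleftrightarrow> (\<forall>i<n. \<forall>j<n. (\<Sum>p<n. Q p i * Q p j) = of_bool (i = j))"

text \<open>Fewer than \<open>n\<close> vectors, padded with zero rows, form a singular square
  matrix; a normalized kernel vector is orthogonal to all of them.\<close>

lemma exists_unit_orthogonal:
  fixes u :: "nat \<Rightarrow> nat \<Rightarrow> real"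
  assumes "k < n"
  obtains v where "(\<Sum>p<n. v p * v p) = 1" "\<And>a. a < k \<Longrightarrow> (\<Sum>p<n. u a p * v p) = 0"
proof -
  define M where "M = Matrix.mat n n (\<lambda>(i, j). if i < k then u i j else 0)"
  have M: "M \<in> carrier_mat n n" by (simp add: M_def)
  have "Determinant.det M = 0"
  proof -
    \<comment> \<open>Row \<open>k\<close> is already zero, so scaling it by 0 changes nothing and
      yields \<open>det M = 0 * det M\<close>.\<close>
    have "multrow k 0 M = M" using assms by (intro eq_matI) (auto simp: M_def)
    then show ?thesis using det_multrow[OF assms M, of 0] by simp
  qed
  then obtain w where w: "w \<in> carrier_vec n" "w \<noteq> 0\<^sub>v n" "M *\<^sub>v w = 0\<^sub>v n"
    using det_0_iff_vec_prod_zero_field[OF M] by blast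
  define W where "W = (\<Sum>p<n. (vec_index w p) * (vec_index w p))"
  have "\<exists>p<n. vec_index w p \<noteq> 0" using w(1,2) by (auto simp: vec_eq_iff)
  then have "W \<noteq> 0" unfolding W_def by (subst sum_nonneg_eq_0_iff) auto
  moreover have "W \<ge> 0" unfolding W_def by (intro sum_nonneg) simp
  ultimately have W: "W > 0" by simp
  show thesis
  proof (rule that[of "\<lambda>p. vec_index w p / sqrt W"])
    have "(\<Sum>p<n. vec_index w p / sqrt W * (vec_index w p / sqrt W)) = (\<Sum>p<n. (vec_index w p * vec_index w p) / W)"
      using W by (intro sum.cong) auto
    also have "\<dots> = 1" using W by (simp add: sum_divide_distrib[symmetric] W_def[symmetric])
    finally show "(\<Sum>p<n. vec_index w p / sqrt W * (vec_index w p / sqrt W)) = 1" .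
  next
    fix a assume a: "a < k"
    then have "vec_index (M *\<^sub>v w) a = 0" using w(3) assms by simp
    moreover have "vec_index (M *\<^sub>v w) a = (\<Sum>p<n. u a p * vec_index w p)"
      using a assms w(1) by (auto simp: M_def scalar_prod_def lessThan_atLeast0 intro!: sum.cong)
    ultimately have "(\<Sum>p<n. u a p * vec_index w p) = 0" by simp
    then show "(\<Sum>p<n. u a p * (vec_index w p / sqrt W)) = 0"
      by (simp add: sum_divide_distrib[symmetric])
  qed
qed

text \<open>Gram-Schmidt for possibly dependent vectors: when the residual vanishes, an arbitrary
  unit vector orthogonal to the earlier ones is inserted with coefficient 0, so the system always
  reaches full length.\<close>

lemma exists_adapted_orthonormal:
  fixes X :: "nat \<Rightarrow> nat \<Rightarrow> real"
  assumes "k \<le> n"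
  shows "\<exists>u c. (\<forall>i<k. \<forall>j<k. (\<Sum>p<n. u i p * u j p) = of_bool (i = j)) \<and>
               (\<forall>i<k. \<forall>p<n. X i p = (\<Sum>a\<le>i. c i a * u a p))"
  using assms
proof (induction k)
  case 0
  then show ?case by auto
next
  case (Suc k)
  then obtain u c where uc: "(\<forall>i<k. \<forall>j<k. (\<Sum>p<n. u i p * u j p) = of_bool (i = j)) \<and>
               (\<forall>i<k. \<forall>p<n. X i p = (\<Sum>a\<le>i. c i a * u a p))"
    using Suc_leD by blast
  then have u: "\<And>i j. i < k \<Longrightarrow> j < k \<Longrightarrow> (\<Sum>p<n. u i p * u j p) = of_bool (i = j)"
    and c: "\<And>i p. i < k \<Longrightarrow> p < n \<Longrightarrow> X i p = (\<Sum>a\<le>i. c i a * u a p)"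
    by blast+
  define d where "d a = (\<Sum>p<n. u a p * X k p)" for a
  define r where "r p = X k p - (\<Sum>a<k. d a * u a p)" for p
  have r: "(\<Sum>p<n. u b p * r p) = 0" if "b < k" for b
  proof -
    have "(\<Sum>p<n. u b p * r p) = d b - (\<Sum>p<n. \<Sum>a<k. d a * (u b p * u a p))"
      by (simp add: r_def d_def right_diff_distrib sum_subtractf sum_distrib_left mult_ac)
    also have "(\<Sum>p<n. \<Sum>a<k. d a * (u b p * u a p)) = (\<Sum>a<k. d a * (\<Sum>p<n. u b p * u a p))"
      by (subst sum.swap) (simp add: sum_distrib_left)
    also have "\<dots> = (\<Sum>a<k. if b = a then d a else 0)" using u that by (intro sum.cong) auto
    also have "\<dots> = d b" using that by simp
    finally show ?thesis by simp
  qed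
  obtain v t where v: "(\<Sum>p<n. v p * v p) = 1" "\<And>a. a < k \<Longrightarrow> (\<Sum>p<n. u a p * v p) = 0"
    and t: "\<And>p. p < n \<Longrightarrow> r p = t * v p"
  proof (cases "(\<Sum>p<n. r p * r p) = 0")
    case True
    then have "\<And>p. p < n \<Longrightarrow> r p = 0"
      by (subst (asm) sum_nonneg_eq_0_iff) auto
    moreover obtain v where "(\<Sum>p<n. v p * v p) = 1" "\<And>a. a < k \<Longrightarrow> (\<Sum>p<n. u a p * v p) = 0"
      using exists_unit_orthogonal[of k n] Suc.prems by (metis Suc_le_lessD)
    ultimately show ?thesis using that[of v 0] by simp
  next
    case False
    define R where "R = (\<Sum>p<n. r p * r p)"
    have R: "R > 0" using False by (simp add: R_def order.strict_iff_order sum_nonneg)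
    have "(\<Sum>p<n. r p / sqrt R * (r p / sqrt R)) = (\<Sum>p<n. (r p * r p) / R)"
      using R by (intro sum.cong) auto
    also have "\<dots> = 1" using R by (simp add: sum_divide_distrib[symmetric] R_def[symmetric])
    finally have 1: "(\<Sum>p<n. r p / sqrt R * (r p / sqrt R)) = 1" .
    have 2: "(\<Sum>p<n. u a p * (r p / sqrt R)) = 0" if "a < k" for a
      using r[OF that] by (simp add: sum_divide_distrib[symmetric])
    show ?thesis using that[of "\<lambda>p. r p / sqrt R" "sqrt R"] 1 2 R by auto
  qed
  define u' where "u' = u(k := v)"
  define c' where "c' = c(k := d(k := t))"
  have "(\<Sum>p<n. u' i p * u' j p) = of_bool (i = j)" if "i < Suc k" "j < Suc k" for i j
    using that u[of i j] v v(2)[of i] v(2)[of j]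
    by (auto simp: u'_def less_Suc_eq mult.commute)
  moreover have "X i p = (\<Sum>a\<le>i. c' i a * u' a p)" if "i < Suc k" "p < n" for i p
  proof (cases "i = k")
    case True
    have "X k p = (\<Sum>a<k. d a * u a p) + t * v p" using t[OF that(2)] by (simp add: r_def)
    also have "\<dots> = (\<Sum>a<Suc k. c' k a * u' a p)"
      by (simp add: c'_def u'_def)
    finally show ?thesis using True by (simp add: lessThan_Suc_atMost)
  next
    case False
    with that have i: "i < k" by simp
    show ?thesis using c[OF i that(2)] i
      by (auto simp: c'_def u'_def intro!: sum.cong)
  qed
  ultimately show ?case by blast
qed

text \<open>The columns of \<open>Q\<close> are the Gram-Schmidt vectors: row \<open>i\<close> of
  \<open>X\<close> lies in the span of those with index at most \<open>i\<close>, hence is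
  orthogonal to all later ones.\<close>

lemma exists_triangularizing:
  fixes X :: "nat \<Rightarrow> nat \<Rightarrow> real"
  obtains Q where "orthonormal_cols n Q"
    "\<And>i j. i < j \<Longrightarrow> j < n \<Longrightarrow> (\<Sum>p<n. X i p * Q p j) = 0"
proof -
  obtain u c where uc: "(\<forall>i<n. \<forall>j<n. (\<Sum>p<n. u i p * u j p) = of_bool (i = j)) \<and>
               (\<forall>i<n. \<forall>p<n. X i p = (\<Sum>a\<le>i. c i a * u a p))"
    using exists_adapted_orthonormal[of n n X] by blast
  then have u: "\<And>i j. i < n \<Longrightarrow> j < n \<Longrightarrow> (\<Sum>p<n. u i p * u j p) = of_bool (i = j)"
    and c: "\<And>i p. i < n \<Longrightarrow> p < n \<Longrightarrow> X i p = (\<Sum>a\<le>i. c i a * u a p)"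
    by blast+
  show thesis
  proof (rule that[of "\<lambda>p j. u j p"])
    show "orthonormal_cols n (\<lambda>p j. u j p)" using u by (simp add: orthonormal_cols_def)
    fix i j :: nat assume ij: "i < j" "j < n"
    have "(\<Sum>p<n. X i p * u j p) = (\<Sum>p<n. \<Sum>a\<le>i. c i a * (u a p * u j p))"
      using c ij by (simp add: sum_distrib_right mult.assoc)
    also have "\<dots> = (\<Sum>a\<le>i. c i a * (\<Sum>p<n. u a p * u j p))"
      by (subst sum.swap) (simp add: sum_distrib_left)
    also have "\<dots> = 0" using u ij by (intro sum.neutral) auto
    finally show "(\<Sum>p<n. X i p * u j p) = 0" .
  qed
qed

lemma orthonormal_cols_mat:
  assumes "orthonormal_cols n Q"
  shows "transpose_mat (Matrix.mat n n (\<lambda>(i, j). Q i j)) * Matrix.mat n n (\<lambda>(i, j). Q i j) = 1\<^sub>m n"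
  using assms by (intro eq_matI)
    (auto simp: orthonormal_cols_def scalar_prod_def lessThan_atLeast0)

text \<open>A left inverse of a square matrix is also a right inverse, so the rows of
  \<open>Q\<close> are orthonormal too; expanding the square then leaves only the diagonal
  terms.\<close>

lemma orthonormal_cols_isometry:
  assumes "orthonormal_cols n Q"
  shows "(\<Sum>j<n. (\<Sum>p<n. x p * Q p j)\<^sup>2) = (\<Sum>p<n. (x p)\<^sup>2)"
proof -
  let ?Q = "Matrix.mat n n (\<lambda>(i, j). Q i j)"
  have "?Q * transpose_mat ?Q = 1\<^sub>m n"
    by (rule mat_mult_left_right_inverse[OF _ _ orthonormal_cols_mat[OF assms]]) auto
  then have rows: "(\<Sum>j<n. Q p j * Q q j) = of_bool (p = q)" if "p < n" "q < n" for p q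
    using that by (auto simp: scalar_prod_def lessThan_atLeast0 mat_eq_iff)
  have "(\<Sum>j<n. (\<Sum>p<n. x p * Q p j)\<^sup>2) = (\<Sum>j<n. \<Sum>p<n. \<Sum>q<n. x p * x q * (Q p j * Q q j))"
    by (simp add: power2_eq_square sum_product mult_ac)
  also have "\<dots> = (\<Sum>p<n. \<Sum>q<n. \<Sum>j<n. x p * x q * (Q p j * Q q j))"
    by (subst sum.swap) (intro sum.cong refl sum.swap)
  also have "\<dots> = (\<Sum>p<n. \<Sum>q<n. if p = q then x p * x q else 0)"
    using rows by (intro sum.cong refl) (auto simp: sum_distrib_left[symmetric])
  also have "\<dots> = (\<Sum>p<n. (x p)\<^sup>2)" by (simp add: power2_eq_square)
  finally show ?thesis .
qed

section \<open>Determinants and Hadamard's inequality\<close>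

definition fdet :: "nat \<Rightarrow> (nat \<Rightarrow> nat \<Rightarrow> real) \<Rightarrow> real" where
  "fdet n M = Determinant.det (Matrix.mat n n (\<lambda>(i, j). M i j))"

lemma fdet_mult: "fdet n (\<lambda>i j. \<Sum>p<n. A i p * B p j) = fdet n A * fdet n B"
proof -
  have "Matrix.mat n n (\<lambda>(i, j). \<Sum>p<n. A i p * B p j) =
      Matrix.mat n n (\<lambda>(i, j). A i j) * Matrix.mat n n (\<lambda>(i, j). B i j)"
    by (intro eq_matI) (auto simp: scalar_prod_def lessThan_atLeast0)
  then show ?thesis unfolding fdet_def by (metis det_mult mat_carrier)
qed

lemma fdet_lower_triangular:
  assumes "\<And>i j. i < j \<Longrightarrow> j < n \<Longrightarrow> A i j = 0"
  shows "fdet n A = (\<Prod>i<n. A i i)"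
proof -
  have "fdet n A = prod_list (diag_mat (Matrix.mat n n (\<lambda>(i, j). A i j)))"
    unfolding fdet_def by (rule det_lower_triangular[of n]) (use assms in auto)
  then show ?thesis by (auto simp: prod_list_diag_prod lessThan_atLeast0 intro!: prod.cong)
qed

lemma abs_fdet_orthonormal:
  assumes "orthonormal_cols n Q"
  shows "\<bar>fdet n Q\<bar> = 1"
proof -
  let ?Q = "Matrix.mat n n (\<lambda>(i, j). Q i j)"
  have "Determinant.det (transpose_mat ?Q * ?Q) = fdet n Q * fdet n Q"
    by (subst det_mult[of _ n]) (auto simp: fdet_def det_transpose[of _ n])
  then have "fdet n Q * fdet n Q = 1" using orthonormal_cols_mat[OF assms] by simp
  then show ?thesis by (simp flip: power2_eq_square add: abs_square_eq_1)
qed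

text \<open>Rotating the rows into triangular form preserves the row norms and the absolute
  determinant, and each diagonal entry is at most the norm of its row.\<close>

lemma Hadamard_inequality: "\<bar>fdet n A\<bar> \<le> (\<Prod>i<n. sqrt (\<Sum>j<n. (A i j)\<^sup>2))"
proof -
  obtain Q where Q: "orthonormal_cols n Q"
    and tri: "\<And>i j. i < j \<Longrightarrow> j < n \<Longrightarrow> (\<Sum>p<n. A i p * Q p j) = 0"
    using exists_triangularizing by blast
  have "\<bar>fdet n A\<bar> = \<bar>fdet n (\<lambda>i j. \<Sum>p<n. A i p * Q p j)\<bar>"
    using abs_fdet_orthonormal[OF Q] by (simp add: fdet_mult abs_mult)
  also have "\<dots> = (\<Prod>i<n. \<bar>\<Sum>p<n. A i p * Q p i\<bar>)"
    using tri by (simp add: fdet_lower_triangular abs_prod)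
  also have "\<dots> \<le> (\<Prod>i<n. sqrt (\<Sum>j<n. (A i j)\<^sup>2))"
  proof (rule prod_mono, rule conjI)
    fix i assume "i \<in> {..<n}"
    then have "(\<Sum>p<n. A i p * Q p i)\<^sup>2 \<le> (\<Sum>j<n. (\<Sum>p<n. A i p * Q p j)\<^sup>2)"
      by (intro member_le_sum) auto
    then show "\<bar>\<Sum>p<n. A i p * Q p i\<bar> \<le> sqrt (\<Sum>j<n. (A i j)\<^sup>2)"
      by (simp add: orthonormal_cols_isometry[OF Q] real_le_rsqrt)
  qed auto
  finally show ?thesis .
qed

lemma fdet_scale_cols: "fdet n (\<lambda>i j. A i j * c j) = fdet n A * (\<Prod>j<n. c j)"
proof -
  have "fdet n (\<lambda>i j. A i j * c j) = fdet n (\<lambda>i j. \<Sum>p<n. A i p * (if p = j then c j else 0))"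
    unfolding fdet_def by (intro arg_cong[where f = Determinant.det] eq_matI) (auto simp: if_distrib cong: if_cong)
  also have "\<dots> = fdet n A * fdet n (\<lambda>p j. if p = j then c j else 0)"
    by (rule fdet_mult)
  also have "fdet n (\<lambda>p j. if p = j then c j else 0) = (\<Prod>j<n. c j)"
    by (subst fdet_lower_triangular) auto
  finally show ?thesis .
qed

section \<open>The determinant bound for products of distances\<close>

lemma linear_vanishes_on_span:
  assumes "linear (\<phi> :: 'a::real_vector \<Rightarrow> real)" "\<And>v. v \<in> S \<Longrightarrow> \<phi> v = 0" "w \<in> span S"
  shows "\<phi> w = 0"
  using linear_eq_on_span[OF assms(1) linear_zero, of S w] assms by auto

lemma linear_sum_scale:
  fixes \<phi> :: "nat \<Rightarrow> 'a::real_vector \<Rightarrow> real"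
  assumes "\<And>p. linear (\<phi> p)"
  shows "linear (\<lambda>v. \<Sum>p<n. \<phi> p v * c p)"
proof (rule linearI)
  show "(\<Sum>p<n. \<phi> p (v + w) * c p) = (\<Sum>p<n. \<phi> p v * c p) + (\<Sum>p<n. \<phi> p w * c p)" for v w
    by (simp add: linear_add[OF assms] distrib_right sum.distrib)
  show "(\<Sum>p<n. \<phi> p (r *\<^sub>R v) * c p) = r *\<^sub>R (\<Sum>p<n. \<phi> p v * c p)" for r v
    by (simp add: linear_scale[OF assms] sum_distrib_left mult.assoc)
qed

text \<open>Back substitution: \<open>\<phi> m\<close> vanishes on all \<open>f i\<close> with
  \<open>i < m\<close>, so it alone fixes the coefficient of \<open>f m\<close>, and the induction
  hypothesis handles the remainder.\<close>

lemma triangular_solve: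
  fixes \<phi> :: "nat \<Rightarrow> 'a::real_vector \<Rightarrow> real"
  assumes lin: "\<And>p. linear (\<phi> p)"
    and "\<And>i. i < m \<Longrightarrow> \<phi> i (f i) \<noteq> 0"
    and "\<And>i p. i < p \<Longrightarrow> p < m \<Longrightarrow> \<phi> p (f i) = 0"
  shows "\<exists>y\<in>span (f ` {..<m}). \<forall>p<m. \<phi> p (v - y) = 0"
  using assms(2,3)
proof (induction m arbitrary: v)
  case 0
  then show ?case by (auto intro: span_zero)
next
  case (Suc m)
  define c where "c = \<phi> m v / \<phi> m (f m)"
  obtain y where y: "y \<in> span (f ` {..<m})" "\<forall>p<m. \<phi> p (v - c *\<^sub>R f m - y) = 0"
    using Suc.IH[of "v - c *\<^sub>R f m"] Suc.prems by auto
  have "\<phi> m y = 0"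
    by (rule linear_vanishes_on_span[OF lin _ y(1)]) (use Suc.prems(2) in auto)
  then have "\<phi> m (v - (c *\<^sub>R f m + y)) = 0"
    using Suc.prems(1)[of m] by (simp add: linear_diff[OF lin] linear_add[OF lin] linear_scale[OF lin] c_def)
  with y(2) have "\<forall>p<Suc m. \<phi> p (v - (c *\<^sub>R f m + y)) = 0"
    by (simp add: less_Suc_eq diff_diff_eq)
  moreover have "c *\<^sub>R f m + y \<in> span (f ` {..<Suc m})"
    using y(1) span_mono[of "f ` {..<m}" "f ` {..<Suc m}"]
    by (intro span_add span_scale) (auto intro: span_base simp: lessThan_Suc)
  ultimately show ?case by blast
qed

text \<open>Here \<open>\<psi>\<close> gives Euclidean coordinates on \<open>Z\<close>, equivalent
  to the norm up to \<open>\<gamma>\<close>. The first \<open>P k\<close> vectors of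
  \<open>x\<close> approximate each \<open>f i\<close> within \<open>e k\<close>. Column
  \<open>j\<close> of the coordinate matrix belongs to block \<open>blk j\<close>, and
  \<open>P (blk j) \<le> j\<close> lets that column vanish on the approximants of its block.\<close>

lemma prod_infdist_span_le:
  fixes f x :: "nat \<Rightarrow> 'a::real_normed_vector" and \<psi> :: "nat \<Rightarrow> 'a \<Rightarrow> real"
    and \<gamma> :: real and e :: "nat \<Rightarrow> real" and blk P :: "nat \<Rightarrow> nat"
  assumes lin: "\<And>p. linear (\<psi> p)" and Z: "subspace Z"
    and norm_le: "\<And>z. z \<in> Z \<Longrightarrow> (norm z)\<^sup>2 \<le> (\<Sum>p<N. (\<psi> p z)\<^sup>2)"
    and le_norm: "\<And>z. z \<in> Z \<Longrightarrow> (\<Sum>p<N. (\<psi> p z)\<^sup>2) \<le> (\<gamma> * norm z)\<^sup>2"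
    and "\<gamma> \<ge> 0" and n: "n \<le> N" and fZ: "\<And>i. i < n \<Longrightarrow> f i \<in> Z"
    and pos: "\<And>i. i < n \<Longrightarrow> infdist (f i) (span (f ` {..<i})) > 0"
    and e: "\<And>k. k \<le> r \<Longrightarrow> e k > 0"
    and approx: "\<And>i k. i < n \<Longrightarrow> k \<le> r \<Longrightarrow> \<exists>w\<in>Z \<inter> span (x ` {..<P k}). norm (f i - w) \<le> e k"
    and blk: "\<And>j. j < n \<Longrightarrow> blk j \<le> r" "\<And>j. j < n \<Longrightarrow> P (blk j) \<le> j"
  shows "(\<Prod>i<n. infdist (f i) (span (f ` {..<i}))) \<le> (\<gamma> * sqrt (real (Suc r))) ^ n * (\<Prod>j<n. e (blk j))"
proof -
  obtain Q where Q: "orthonormal_cols N Q"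
    and triQ: "\<And>i q. i < q \<Longrightarrow> q < N \<Longrightarrow> (\<Sum>p<N. \<psi> p (f i) * Q p q) = 0"
    using exists_triangularizing[of N "\<lambda>i p. \<psi> p (f i)"] by blast
  define \<phi> where "\<phi> q v = (\<Sum>p<N. \<psi> p v * Q p q)" for q v
  have lin\<phi>: "linear (\<phi> q)" for q
    unfolding \<phi>_def by (intro linear_sum_scale lin)
  have \<phi>_sum: "(\<Sum>q<N. (\<phi> q v)\<^sup>2) = (\<Sum>p<N. (\<psi> p v)\<^sup>2)" for v
    unfolding \<phi>_def by (rule orthonormal_cols_isometry[OF Q])
  have tri\<phi>: "\<phi> q (f i) = 0" if "i < q" "q < N" for i q
    using triQ[OF that] by (simp add: \<phi>_def)

  \<comment> \<open>By induction and \<open>pos\<close> the earlier diagonal entries are nonzero, so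
    some \<open>y\<close> in the span cancels the first \<open>i\<close> coordinates of
    \<open>f i\<close>. Triangularity kills those after \<open>i\<close>, leaving
    \<open>\<phi> i (f i)\<close> as the only coordinate of \<open>f i - y\<close>.\<close>
  have diag: "infdist (f i) (span (f ` {..<i})) \<le> \<bar>\<phi> i (f i)\<bar>" if "i < n" for i
    using that
  proof (induction i rule: less_induct)
    case (less i)
    have "\<exists>y\<in>span (f ` {..<i}). \<forall>p<i. \<phi> p (f i - y) = 0"
    proof (rule triangular_solve[OF lin\<phi>])
      fix j assume "j < i"
      then show "\<phi> j (f j) \<noteq> 0" using less pos[of j] by fastforce
    qed (use tri\<phi> less.prems n in auto)
    then obtain y where y: "y \<in> span (f ` {..<i})" "\<And>p. p < i \<Longrightarrow> \<phi> p (f i - y) = 0" by blast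
    have yp: "\<phi> p y = 0" if "i \<le> p" "p < N" for p
      by (rule linear_vanishes_on_span[OF lin\<phi> _ y(1)]) (use tri\<phi> that in auto)
    have "span (f ` {..<i}) \<subseteq> Z"
      by (rule span_minimal[OF _ Z]) (use fZ less.prems in auto)
    then have "f i - y \<in> Z" using y fZ[OF less.prems] Z by (auto intro: subspace_diff)
    then have "(norm (f i - y))\<^sup>2 \<le> (\<Sum>q<N. (\<phi> q (f i - y))\<^sup>2)"
      using norm_le by (simp add: \<phi>_sum)
    also have "\<dots> = (\<Sum>q<N. if q = i then (\<phi> i (f i))\<^sup>2 else 0)"
    proof (rule sum.cong[OF refl])
      fix q assume "q \<in> {..<N}"
      then show "(\<phi> q (f i - y))\<^sup>2 = (if q = i then (\<phi> i (f i))\<^sup>2 else 0)"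
        using y(2)[of q] yp[of q] tri\<phi>[of i q]
        by (cases q i rule: linorder_cases) (auto simp: linear_diff[OF lin\<phi>])
    qed
    also have "\<dots> = (\<phi> i (f i))\<^sup>2" using less.prems n by simp
    finally have "norm (f i - y) \<le> \<bar>\<phi> i (f i)\<bar>"
      by (simp add: abs_le_square_iff[symmetric])
    then show ?case using infdist_le2[OF y(1), of "f i"] by (simp add: dist_norm)
  qed

  \<comment> \<open>The first \<open>n\<close> functionals \<open>\<phi>\<close> are the coordinates of the orthogonal projection onto the span of the
    \<open>f i\<close>; rotating only those keeps the matrix of the \<open>f i\<close> square.\<close>
  obtain R where R: "orthonormal_cols n R"
    and triR: "\<And>i j. i < j \<Longrightarrow> j < n \<Longrightarrow> (\<Sum>q<n. \<phi> q (x i) * R q j) = 0"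
    using exists_triangularizing[of n "\<lambda>i q. \<phi> q (x i)"] by blast
  define \<theta> where "\<theta> j v = (\<Sum>q<n. \<phi> q v * R q j)" for j v
  have lin\<theta>: "linear (\<theta> j)" for j
    unfolding \<theta>_def by (intro linear_sum_scale lin\<phi>)
  have \<theta>_sum: "(\<Sum>j<n. (\<theta> j z)\<^sup>2) \<le> (\<gamma> * norm z)\<^sup>2" if "z \<in> Z" for z
  proof -
    have "(\<Sum>j<n. (\<theta> j z)\<^sup>2) = (\<Sum>q<n. (\<phi> q z)\<^sup>2)"
      unfolding \<theta>_def by (rule orthonormal_cols_isometry[OF R])
    also have "\<dots> \<le> (\<Sum>q<N. (\<phi> q z)\<^sup>2)" using n by (intro sum_mono2) auto
    also have "\<dots> \<le> (\<gamma> * norm z)\<^sup>2" using le_norm[OF that] by (simp add: \<phi>_sum)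
    finally show ?thesis .
  qed
  \<comment> \<open>The coordinates in block \<open>k\<close> vanish on the approximant
    \<open>w\<close>, so they see only the error \<open>f i - w\<close>, whose size
    \<open>e k\<close> the scaling cancels.\<close>
  have block: "(\<Sum>j\<in>{j\<in>{..<n}. blk j = k}. (\<theta> j (f i) * inverse (e (blk j)))\<^sup>2) \<le> \<gamma>\<^sup>2"
    if i: "i < n" and k: "k \<le> r" for i k
  proof -
    obtain w where w: "w \<in> Z" "w \<in> span (x ` {..<P k})" "norm (f i - w) \<le> e k"
      using approx[OF i k] by auto
    have "\<theta> j w = 0" if "j < n" "blk j = k" for j
      by (rule linear_vanishes_on_span[OF lin\<theta> _ w(2)])
         (use triR blk(2)[OF that(1)] that in \<open>auto simp: \<theta>_def\<close>)
    then have "(\<Sum>j\<in>{j\<in>{..<n}. blk j = k}. (\<theta> j (f i) * inverse (e (blk j)))\<^sup>2)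
        = (\<Sum>j\<in>{j\<in>{..<n}. blk j = k}. (\<theta> j (f i - w))\<^sup>2) * (inverse (e k))\<^sup>2"
      by (simp add: sum_distrib_right linear_diff[OF lin\<theta>] power_mult_distrib)
    also have "\<dots> \<le> (\<gamma> * norm (f i - w))\<^sup>2 * (inverse (e k))\<^sup>2"
    proof (rule mult_right_mono)
      have "(\<Sum>j\<in>{j\<in>{..<n}. blk j = k}. (\<theta> j (f i - w))\<^sup>2) \<le> (\<Sum>j<n. (\<theta> j (f i - w))\<^sup>2)"
        by (intro sum_mono2) auto
      also have "\<dots> \<le> (\<gamma> * norm (f i - w))\<^sup>2"
        by (rule \<theta>_sum) (use fZ[OF i] w(1) Z in \<open>auto intro: subspace_diff\<close>)
      finally show "(\<Sum>j\<in>{j\<in>{..<n}. blk j = k}. (\<theta> j (f i - w))\<^sup>2) \<le> (\<gamma> * norm (f i - w))\<^sup>2" .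
    qed simp
    also have "\<dots> \<le> (\<gamma> * e k)\<^sup>2 * (inverse (e k))\<^sup>2"
      using w(3) \<open>\<gamma> \<ge> 0\<close> by (intro mult_right_mono power_mono mult_left_mono) auto
    also have "\<dots> = \<gamma>\<^sup>2" using e[OF k] by (simp add: power_mult_distrib field_simps)
    finally show ?thesis .
  qed
  have row: "sqrt (\<Sum>j<n. (\<theta> j (f i) * inverse (e (blk j)))\<^sup>2) \<le> \<gamma> * sqrt (real (Suc r))"
    if i: "i < n" for i
  proof -
    have "(\<Sum>j<n. (\<theta> j (f i) * inverse (e (blk j)))\<^sup>2)
        = (\<Sum>k\<le>r. \<Sum>j\<in>{j\<in>{..<n}. blk j = k}. (\<theta> j (f i) * inverse (e (blk j)))\<^sup>2)"
      by (rule sum.group[symmetric]) (use blk(1) in auto)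
    also have "\<dots> \<le> (\<Sum>k\<le>r. \<gamma>\<^sup>2)" using block[OF i] by (intro sum_mono) auto
    also have "\<dots> = (\<gamma> * sqrt (real (Suc r)))\<^sup>2" by (simp add: power_mult_distrib)
    finally show ?thesis using \<open>\<gamma> \<ge> 0\<close> by (intro real_le_lsqrt) (auto intro: sum_nonneg)
  qed

  have epos: "(\<Prod>j<n. e (blk j)) > 0" using e blk(1) by (intro prod_pos) auto
  \<comment> \<open>The diagonal product is a triangular determinant; the rotation \<open>R\<close>
    keeps its absolute value, and column scaling prepares it for Hadamard's inequality.\<close>
  have "(\<Prod>i<n. infdist (f i) (span (f ` {..<i}))) \<le> (\<Prod>i<n. \<bar>\<phi> i (f i)\<bar>)"
    using diag by (intro prod_mono) (auto simp: infdist_nonneg)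
  also have "\<dots> = \<bar>fdet n (\<lambda>i q. \<phi> q (f i))\<bar>"
    using tri\<phi> n by (subst fdet_lower_triangular) (auto simp: abs_prod)
  also have "\<dots> = \<bar>fdet n (\<lambda>i j. \<theta> j (f i))\<bar>"
    unfolding \<theta>_def fdet_mult by (simp add: abs_mult abs_fdet_orthonormal[OF R])
  also have "\<dots> = \<bar>fdet n (\<lambda>i j. \<theta> j (f i) * inverse (e (blk j)))\<bar> * (\<Prod>j<n. e (blk j))"
  proof -
    have "(\<Prod>j<n. inverse (e (blk j))) * (\<Prod>j<n. e (blk j)) = 1"
      unfolding prod.distrib[symmetric]
      using e[OF blk(1)]
      by (intro prod.neutral ballI left_inverse) force
    moreover have "(\<Prod>j<n. inverse (e (blk j))) \<ge> 0"
      using e[OF blk(1)] by (intro prod_nonneg) (auto intro: less_imp_le)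
    ultimately show ?thesis by (simp only: fdet_scale_cols abs_mult abs_of_nonneg mult.assoc mult_1_right)
  qed
  also have "\<dots> \<le> (\<Prod>i<n. sqrt (\<Sum>j<n. (\<theta> j (f i) * inverse (e (blk j)))\<^sup>2)) * (\<Prod>j<n. e (blk j))"
    using epos by (intro mult_right_mono Hadamard_inequality) auto
  also have "\<dots> \<le> (\<Prod>i<n. \<gamma> * sqrt (real (Suc r))) * (\<Prod>j<n. e (blk j))"
    using epos row by (intro mult_right_mono prod_mono) (auto intro!: sum_nonneg)
  finally show ?thesis by simp
qed

section \<open>Euclidean coordinates from the Banach-Mazur distance\<close>

text \<open>An isomorphism of subspaces is constrained only on its domain; extending from a basis of
  \<open>V\<close> makes its coordinates linear functionals on the whole space.\<close>

lemma linear_extension_from_subspace: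
  fixes T :: "'a::real_vector \<Rightarrow> 'b::real_vector"
  assumes V: "subspace V"
    and add: "\<And>x y. x \<in> V \<Longrightarrow> y \<in> V \<Longrightarrow> T (x + y) = T x + T y"
    and scale: "\<And>c x. x \<in> V \<Longrightarrow> T (c *\<^sub>R x) = c *\<^sub>R T x"
  obtains T' where "linear T'" "\<And>x. x \<in> V \<Longrightarrow> T' x = T x"
proof -
  obtain B where B: "B \<subseteq> V" "independent B" "V \<subseteq> span B"
    using maximal_independent_subset by blast
  obtain T' where T': "linear T'" "\<And>b. b \<in> B \<Longrightarrow> T' b = T b"
    using linear_independent_extend[OF B(2), of T] by blast
  have "x \<in> V \<and> T' x = T x" if "x \<in> span B" for x
    using that
  proof (induction rule: span_induct_alt)
    case base
    show ?case using subspace_0[OF V] scale[of 0 0] linear_0[OF T'(1)] by simp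
  next
    case (step c b y)
    then show ?case using B(1) T' V
      by (auto simp: linear_add linear_scale add scale subspace_scale intro!: subspace_add)
  qed
  then show thesis using that T'(1) B(3) by blast
qed

text \<open>A supremum of reals is informative only over a bounded set, and \<open>B\<close>
  provides the bound. Where \<open>normV x = 0\<close> the quotient is 0 by convention, so there the
  estimate comes directly from the hypothesis.\<close>

lemma op_norm_on_bounds:
  assumes "V \<noteq> {}" "\<And>x. normV x \<ge> 0" "\<And>y. normW y \<ge> 0" "\<And>x. x \<in> V \<Longrightarrow> normW (T x) \<le> B * normV x"
  shows "op_norm_on V normV normW T \<ge> 0"
    and "x \<in> V \<Longrightarrow> normW (T x) \<le> op_norm_on V normV normW T * normV x"
proof -
  have bdd: "bdd_above ((\<lambda>x. normW (T x) / normV x) ` V)"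
  proof (rule bdd_aboveI2)
    fix x assume x: "x \<in> V"
    \<comment> \<open>The absolute value is taken because \<open>B\<close> may be negative and the
      quotient may be \<open>0 / 0 = 0\<close>.\<close>
    show "normW (T x) / normV x \<le> \<bar>B\<bar>"
    proof (cases "normV x = 0")
      case False
      then have "normV x > 0" using assms(2)[of x] by simp
      moreover have "B * normV x \<le> \<bar>B\<bar> * normV x" using assms(2) by (intro mult_right_mono) auto
      ultimately show ?thesis using order_trans[OF assms(4)[OF x]] by (simp add: divide_le_eq)
    qed simp
  qed
  have le: "normW (T x) / normV x \<le> op_norm_on V normV normW T" if "x \<in> V" for x
    unfolding op_norm_on_def by (rule cSUP_upper[OF that bdd])
  then show "op_norm_on V normV normW T \<ge> 0"
    using assms(1-3) by (metis divide_nonneg_nonneg ex_in_conv order_trans)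
  show "normW (T x) \<le> op_norm_on V normV normW T * normV x" if "x \<in> V" for x
  proof (cases "normV x = 0")
    case True
    then show ?thesis using assms(4)[OF that] by simp
  next
    case False
    then have "normV x > 0" using assms(2)[of x] by simp
    then show ?thesis using le[OF that] by (simp add: divide_le_eq)
  qed
qed

lemma l2_norm_nonneg: "l2_norm y \<ge> 0"
  by (simp add: l2_norm_def L2_set_nonneg)

lemma l2_norm_power2:
  assumes "y \<in> l2_space m" "m \<le> N"
  shows "(l2_norm y)\<^sup>2 = (\<Sum>p<N. (Poly_Mapping.lookup y p)\<^sup>2)"
proof -
  have "(l2_norm y)\<^sup>2 = (\<Sum>p\<in>Poly_Mapping.keys y. (Poly_Mapping.lookup y p)\<^sup>2)"
    by (simp add: l2_norm_def L2_set_def sum_nonneg)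
  also have "\<dots> = (\<Sum>p<N. (Poly_Mapping.lookup y p)\<^sup>2)"
    using assms by (intro sum.mono_neutral_left) (auto simp: l2_space_def in_keys_iff)
  finally show ?thesis .
qed

lemma lookup_scaleR: "Poly_Mapping.lookup (c *\<^sub>R y) p = c * Poly_Mapping.lookup y p"
  for y :: "'b \<Rightarrow>\<^sub>0 real"
proof -
  have "finite {i. c *\<^sub>R Poly_Mapping.lookup y i \<noteq> 0}"
    by (rule finite_subset[OF _ finite_lookup[of y]]) auto
  then show ?thesis by (simp add: scaleR_poly_mapping_def Abs_poly_mapping_inverse)
qed

text \<open>Strictness yields an isomorphism whose norm product is at most \<open>\<gamma>\<close>.
  Scaling its coordinates by the norm of the inverse puts the whole distortion into the upper bound;
  coordinates from \<open>m\<close> up to \<open>N\<close> are zero on \<open>Z\<close>.\<close>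

lemma bm_gamma_functionals:
  fixes Z :: "'a::real_normed_vector set"
  assumes Z: "Z \<in> subspaces_of_dim m" and m: "m \<le> N" and less: "bm_gamma TYPE('a) m < ennreal \<gamma>"
  obtains \<psi> :: "nat \<Rightarrow> 'a \<Rightarrow> real" where "\<And>p. linear (\<psi> p)"
    "\<And>z. z \<in> Z \<Longrightarrow> (norm z)\<^sup>2 \<le> (\<Sum>p<N. (\<psi> p z)\<^sup>2)"
    "\<And>z. z \<in> Z \<Longrightarrow> (\<Sum>p<N. (\<psi> p z)\<^sup>2) \<le> (\<gamma> * norm z)\<^sup>2"
proof -
  let ?W = "l2_space m"
  have "subspace Z" using Z by (simp add: subspaces_of_dim_def)
  have "banach_mazur Z norm ?W l2_norm < ennreal \<gamma>"
    using less Z unfolding bm_gamma_def by (meson SUP_upper le_less_trans)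
  then obtain T where T: "isomorphism_on Z norm ?W l2_norm T"
    and Tless: "ennreal (op_norm_on Z norm l2_norm T * op_norm_on ?W l2_norm norm (inv_into Z T)) < ennreal \<gamma>"
    unfolding banach_mazur_def INF_less_iff by blast
  define a b where "a = op_norm_on Z norm l2_norm T" and "b = op_norm_on ?W l2_norm norm (inv_into Z T)"
  \<comment> \<open>Although \<open>ennreal\<close> truncates negative reals to 0, it is monotone,
    so the strict inequality carries back to the reals.\<close>
  have ab: "b * a \<le> \<gamma>"
    using Tless unfolding a_def b_def by (metis ennreal_leI linorder_not_le mult.commute nle_le)
  have bij: "bij_betw T Z ?W" using T by (simp add: isomorphism_on_def)
  obtain B B' where BB': "\<And>x. x \<in> Z \<Longrightarrow> l2_norm (T x) \<le> B * norm x"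
      "\<And>y. y \<in> ?W \<Longrightarrow> norm (inv_into Z T y) \<le> B' * l2_norm y"
    using T unfolding isomorphism_on_def by blast
  have "Z \<noteq> {}" "?W \<noteq> {}" using subspace_0[OF \<open>subspace Z\<close>] bij by (auto simp: bij_betw_def)
  have a: "a \<ge> 0" "\<And>x. x \<in> Z \<Longrightarrow> l2_norm (T x) \<le> a * norm x"
    unfolding a_def using op_norm_on_bounds[where normV = norm and normW = l2_norm and T = T and B = B and V = Z]
      \<open>Z \<noteq> {}\<close> BB'(1) l2_norm_nonneg by auto
  have b: "b \<ge> 0" "\<And>y. y \<in> ?W \<Longrightarrow> norm (inv_into Z T y) \<le> b * l2_norm y"
    unfolding b_def using op_norm_on_bounds[where normV = l2_norm and normW = norm and T = "inv_into Z T" and B = B' and V = ?W]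
      \<open>?W \<noteq> {}\<close> BB'(2) l2_norm_nonneg by auto
  obtain T' where T': "linear T'" "\<And>x. x \<in> Z \<Longrightarrow> T' x = T x"
    using linear_extension_from_subspace[OF \<open>subspace Z\<close>, of T] T unfolding isomorphism_on_def by metis
  define \<psi> where "\<psi> p x = b * Poly_Mapping.lookup (T' x) p" for p x
  have sum: "(\<Sum>p<N. (\<psi> p z)\<^sup>2) = (b * l2_norm (T z))\<^sup>2" if "z \<in> Z" for z
  proof -
    have "T z \<in> ?W" using bij that by (auto simp: bij_betw_def)
    then show ?thesis using T'(2)[OF that]
      by (simp add: \<psi>_def power_mult_distrib sum_distrib_left l2_norm_power2[OF _ m])
  qed
  show thesis
  proof
    show "linear (\<psi> p)" for p
      by (rule linearI) (simp_all add: \<psi>_def linear_add[OF T'(1)] linear_scale[OF T'(1)] lookup_add lookup_scaleR distrib_left)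
  next
    fix z assume z: "z \<in> Z"
    have "T z \<in> ?W" "inv_into Z T (T z) = z" using bij z by (auto simp: bij_betw_def)
    then have "norm z \<le> b * l2_norm (T z)" using b(2)[of "T z"] by simp
    then show "(norm z)\<^sup>2 \<le> (\<Sum>p<N. (\<psi> p z)\<^sup>2)" by (simp add: sum[OF z] power_mono)
    have "b * l2_norm (T z) \<le> b * (a * norm z)" using a(2)[OF z] b(1) by (rule mult_left_mono)
    also have "\<dots> \<le> \<gamma> * norm z" using ab by (simp add: mult.assoc[symmetric] mult_right_mono)
    finally show "(\<Sum>p<N. (\<psi> p z)\<^sup>2) \<le> (\<gamma> * norm z)\<^sup>2"
      using b(1) by (simp add: sum[OF z] power_mono l2_norm_nonneg)
  qed
qed

section \<open>Consequences of the width bounds and of the greedy choice\<close>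

lemma kolmogorov_width_0_upper:
  assumes "bounded K" "h \<in> K"
  shows "norm h \<le> kolmogorov_width K 0"
  using assms by (auto simp: kolmogorov_width_def bounded_iff intro!: cSUP_upper bdd_aboveI2)

lemma kolmogorov_width_less:
  fixes K :: "'a::real_normed_vector set"
  assumes K: "bounded K" "K \<noteq> {}" and n: "n \<ge> 1" and less: "kolmogorov_width K n < c"
  shows "\<exists>b. \<forall>h\<in>K. \<exists>w\<in>span (b ` {..<n}). norm (h - w) < c"
proof -
  have sub: "subspace L" "\<exists>B. finite B \<and> L = span B" "dim L \<le> n"
    if "L \<in> kolmogorov_subspaces n" for L :: "'a set"
    using that by (auto simp: kolmogorov_subspaces_def subspaces_of_dim_def split: if_splits)
  obtain M where M: "\<And>h. h \<in> K \<Longrightarrow> norm h \<le> M" using K(1) by (auto simp: bounded_iff)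
  have bdd: "bdd_above ((\<lambda>h. infdist h L) ` K)" if "L \<in> kolmogorov_subspaces n" for L :: "'a set"
  proof (rule bdd_aboveI2)
    fix h assume "h \<in> K"
    then show "infdist h L \<le> M"
      using infdist_le[OF subspace_0[OF sub(1)[OF that]], of h] M[of h] by simp
  qed
  \<comment> \<open>The zero space keeps the fallback family of subspaces nonempty, so the infimum
    is genuine.\<close>
  have "{0} \<in> (subspaces_of_dim 0 :: 'a set set)"
    using dim_eq_card[of "{}" "{0 :: 'a}"] independent_empty by (auto simp: subspaces_of_dim_def intro!: exI[of _ "{}"])
  then have ne: "kolmogorov_subspaces n \<noteq> ({} :: 'a set set)"
    by (auto simp: kolmogorov_subspaces_def)
  obtain h0 where "h0 \<in> K" using K(2) by blast
  have "bdd_below ((\<lambda>L. SUP h\<in>K. infdist h L) ` kolmogorov_subspaces n)"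
    by (rule bdd_belowI2[of _ 0]) (rule cSUP_upper2[OF bdd \<open>h0 \<in> K\<close> infdist_nonneg])
  then obtain L where L: "L \<in> kolmogorov_subspaces n" "(SUP h\<in>K. infdist h L) < c"
    using less n cINF_less_iff[OF ne] by (auto simp: kolmogorov_width_def)
  obtain B where B: "B \<subseteq> L" "independent B" "L \<subseteq> span B" "card B = dim L"
    using basis_exists by blast
  have "finite B" using sub(2)[OF L(1)] B(1,2) independent_span_bound by metis
  then obtain b where b: "bij_betw b {0..<card B} B" using ex_bij_betw_nat_finite by blast
  \<comment> \<open>The basis may have fewer than \<open>n\<close> elements; the remaining values of
    \<open>b\<close> are arbitrary and can only enlarge the span.\<close>
  have "B \<subseteq> b ` {..<n}" using b B(4) sub(3)[OF L(1)] by (force simp: bij_betw_def)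
  then have Lb: "L \<subseteq> span (b ` {..<n})" using B(3) span_mono by blast
  have "\<exists>w\<in>span (b ` {..<n}). norm (h - w) < c" if h: "h \<in> K" for h
  proof -
    have "infdist h L < c" using cSUP_upper[OF h bdd[OF L(1)]] L(2) by simp
    moreover have "L \<noteq> {}" using subspace_0[OF sub(1)[OF L(1)]] by auto
    ultimately obtain w where "w \<in> L" "dist h w < c"
      by (metis (mono_tags, lifting) cINF_greatest infdist_notempty linorder_not_le)
    then show ?thesis using Lb by (auto simp: dist_norm)
  qed
  then show ?thesis by blast
qed

text \<open>Shrinking the span increases the distance, and at stage \<open>i\<close> the element
  \<open>f i\<close> is the farthest in \<open>K\<close>. For \<open>i = 0\<close> the span is
  \<open>{0}\<close> and the distance is the norm.\<close>

lemma greedy_error_le_infdist: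
  assumes f: "greedy_sequence K f" and "i \<le> n" and n: "n \<ge> 1"
  shows "greedy_error f n \<le> infdist (f i) (span (f ` {..<i}))"
proof -
  have "greedy_error f n = infdist (f n) (span (f ` {..<n}))"
    using n by (simp add: greedy_error_def greedy_space_def)
  also have "\<dots> \<le> infdist (f n) (span (f ` {..<i}))"
    by (intro infdist_mono span_mono) (use \<open>i \<le> n\<close> span_zero in auto)
  also have "\<dots> \<le> infdist (f i) (span (f ` {..<i}))"
  proof (cases "i = 0")
    case True
    then show ?thesis using f by (simp add: greedy_sequence_def infdist_def)
  next
    case False
    then show ?thesis using f by (simp add: greedy_sequence_def greedy_space_def)
  qed
  finally show ?thesis .
qed

section \<open>Numerical estimates\<close>

text \<open>The quotient of \<open>n ^ n\<close> by \<open>fact n\<close> is one term of the series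
  for \<open>exp n\<close>, and \<open>exp 1\<close> is below 4.\<close>

lemma power_self_le_fact: "real n ^ n \<le> 4 ^ n * fact n"
proof -
  have "(\<Sum>k\<in>{n}. real n ^ k /\<^sub>R fact k) \<le> exp (real n)"
    unfolding exp_def by (rule sum_le_suminf[OF summable_exp_generic]) auto
  also have "exp (real n) = exp 1 ^ n" using exp_of_nat_mult[of n "1::real"] by simp
  also have "\<dots> \<le> 4 ^ n" using exp_le by (intro power_mono) auto
  finally show ?thesis by (simp add: field_simps)
qed

text \<open>The 16 is the 4 in each factor times the 4 from bounding the factorial.\<close>

lemma prod_powr_le:
  assumes "s \<ge> 0" "c \<ge> 0" "n \<ge> 1"
  shows "(\<Prod>j<n. c * (4 / real (Suc j)) powr s) \<le> (c * (16 powr s * real n powr (- s))) ^ n"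
proof -
  have "(\<Prod>j<n. (4 / real (Suc j)) powr s) = (\<Prod>j<n. 4 / real (Suc j)) powr s"
    by (rule prod_powr_distrib[symmetric])
  also have "(\<Prod>j<n. 4 / real (Suc j)) = 4 ^ n / fact n"
    by (induction n) (simp_all del: of_nat_Suc add: mult.commute)
  also have "(4 ^ n / fact n) powr s \<le> ((16 / real n) ^ n) powr s"
  proof (rule powr_mono2)
    have "(4::real) ^ n * real n ^ n \<le> 4 ^ n * (4 ^ n * fact n)"
      by (intro mult_left_mono power_self_le_fact) simp
    also have "\<dots> = (4 * 4) ^ n * fact n" by (simp only: power_mult_distrib mult.assoc)
    finally show "4 ^ n / fact n \<le> (16 / real n) ^ n" using \<open>n \<ge> 1\<close> by (simp add: field_simps)
  qed (use \<open>s \<ge> 0\<close> in auto)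
  also have "\<dots> = ((16 / real n) powr s) ^ n"
    using \<open>n \<ge> 1\<close> by (simp add: powr_realpow[symmetric] powr_powr mult.commute)
  also have "(16 / real n) powr s = 16 powr s * real n powr (- s)"
    by (simp add: powr_divide powr_minus_divide)
  finally show ?thesis
    using \<open>c \<ge> 0\<close> by (simp only: prod.distrib prod_constant card_lessThan power_mult_distrib mult_left_mono zero_le_power)
qed

section \<open>Dyadic blocks and the bound on the greedy error\<close>

lemma binary_block_unique:
  fixes q :: nat
  assumes "2 ^ u \<le> q" "q < 2 ^ (u + 1)" "2 ^ v \<le> q" "q < 2 ^ (v + 1)"
  shows "u = v"
proof -
  have "(2::nat) ^ u < 2 ^ (v + 1)" "(2::nat) ^ v < 2 ^ (u + 1)" using assms by linarith+
  then have "u < v + 1" "v < u + 1" 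
    using power_less_imp_less_exp[of "2::nat" u "v + 1"] power_less_imp_less_exp[of "2::nat" v "u + 1"]
    by simp_all
  then show ?thesis by simp
qed

text \<open>The strict bounds guarantee that actual subspaces and isomorphisms attain the constants,
  although the infima need not be attained.\<close>

lemma greedy_error_le:
  fixes K :: "'a::real_normed_vector set" and c \<gamma> s :: real
  assumes K: "bounded K" and f: "greedy_sequence K f" and n: "n \<ge> 1" and s: "s \<ge> 0"
    and c: "c > 0" and \<gamma>: "\<gamma> \<ge> 0"
    and width: "\<And>n. kolmogorov_width K n < c * real (max 1 n) powr (- s)"
    and bm: "\<And>m. 1 \<le> m \<Longrightarrow> m \<le> 2 * n \<Longrightarrow> bm_gamma TYPE('a) m < ennreal \<gamma>"
  shows "greedy_error f n \<le> \<gamma> * sqrt (log 2 (2 * real n)) * (c * (16 powr s * real n powr (- s)))"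
proof (cases "greedy_error f n > 0")
  case False
  have "log 2 (2 * real n) \<ge> 0" using n by simp
  then have "0 \<le> \<gamma> * sqrt (log 2 (2 * real n)) * (c * (16 powr s * real n powr (- s)))"
    using \<gamma> c by simp
  then show ?thesis using False by linarith
next
  case True
  have pos: "infdist (f i) (span (f ` {..<i})) > 0" if "i < n" for i
    using greedy_error_le_infdist[OF f, of i n] that True by simp
  have fK: "f i \<in> K" for i using f by (simp add: greedy_sequence_def)
  obtain a where a: "2 ^ a \<le> n" "n < 2 ^ (a + 1)"
    using ex_power_ivl1[of 2 n] n by auto
  \<comment> \<open>Thus \<open>blk j\<close> is the integer part of the binary logarithm of
    \<open>j + 1\<close>.\<close>
  have "\<forall>j. \<exists>k. 2 ^ k \<le> Suc j \<and> Suc j < 2 ^ (k + 1)"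
    using ex_power_ivl1[of 2] by simp
  then obtain blk where blk: "\<And>j. 2 ^ blk j \<le> Suc j" "\<And>j. Suc j < 2 ^ (blk j + 1)"
    by metis
  have "\<exists>b. \<forall>h\<in>K. \<exists>w\<in>span (b ` {..<(2::nat) ^ k}). norm (h - w) < c * (2 ^ k) powr (- s)" for k
    using kolmogorov_width_less[OF K _ _ width[of "2 ^ k"]] fK by (auto simp: max_absorb2)
  then obtain b where b: "\<And>k h. h \<in> K \<Longrightarrow>
      \<exists>w\<in>span (b k ` {..<(2::nat) ^ k}). norm (h - w) < c * (2 ^ k) powr (- s)"
    by metis
  \<comment> \<open>The indices \<open>p\<close> with \<open>2\<^sup>k \<le> p + 1 < 2\<^sup>k\<^sup>+\<^sup>1\<close> enumerate the spanning set \<open>b k\<close> of the \<open>k\<close>-th subspace.\<close>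
  define x where "x p = b (blk p) (p - (2 ^ blk p - 1))" for p
  \<comment> \<open>The first \<open>k\<close> subspaces use
    \<open>1 + 2 + ... + 2 ^ (k - 1) = 2 ^ k - 1\<close> spanning vectors in total.\<close>
  define P :: "nat \<Rightarrow> nat" where "P k = 2 ^ k - 1" for k
  \<comment> \<open>Block \<open>k\<close> relies on subspace \<open>k - 1\<close>, the last one
    listed before position \<open>P k\<close>. Block 0 has none before it, so its approximant is 0
    and \<open>c\<close> bounds the norm.\<close>
  define e where "e k = (if k = 0 then c else c * (2 ^ (k - 1)) powr (- s))" for k
  define Z where "Z = span (f ` {..<n} \<union> x ` {..<P a})"
  have xb: "b k ` {..<2 ^ k} \<subseteq> x ` {..<P (Suc k)}" for k
  proof safe
    fix i :: nat assume i: "i < 2 ^ k"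
    define p where "p = 2 ^ k - 1 + i"
    have p: "Suc p = 2 ^ k + i" by (simp add: p_def)
    have "blk p = k"
      by (rule binary_block_unique[OF blk]) (use i p in auto)
    then have "x p = b k i" by (simp add: x_def p_def)
    moreover have "p < P (Suc k)" using i p by (simp add: P_def)
    ultimately show "b k i \<in> x ` {..<P (Suc k)}" by (metis imageI lessThan_iff)
  qed
  have approx: "\<exists>w\<in>Z \<inter> span (x ` {..<P k}). norm (f i - w) \<le> e k" if i: "i < n" and k: "k \<le> a" for i k
  proof (cases k)
    case 0
    have "norm (f i) \<le> c"
      using kolmogorov_width_0_upper[OF K fK[of i]] width[of 0] by simp
    then show ?thesis using 0 by (intro bexI[of _ 0]) (auto simp: e_def Z_def span_zero)
  next
    case (Suc l)
    obtain w where w: "w \<in> span (b l ` {..<2 ^ l})" "norm (f i - w) < c * (2 ^ l) powr (- s)"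
      using b[OF fK[of i]] by blast
    have wx: "w \<in> span (x ` {..<P k})" using w(1) span_mono[OF xb[of l]] Suc by auto
    have "P k \<le> P a" using k by (simp add: P_def diff_le_mono)
    then have "span (x ` {..<P k}) \<subseteq> Z" unfolding Z_def by (intro span_mono) auto
    then show ?thesis using wx w(2) Suc by (intro bexI[of _ w]) (auto simp: e_def)
  qed
  define m where "m = dim Z"
  have Zdim: "Z \<in> subspaces_of_dim m"
    unfolding subspaces_of_dim_def m_def Z_def by (auto intro!: exI[of _ "f ` {..<n} \<union> x ` {..<P a}"])
  have "m \<le> card (f ` {..<n} \<union> x ` {..<P a})"
    unfolding m_def by (rule dim_le_card) (auto simp: Z_def)
  also have "\<dots> \<le> n + P a"
    by (rule order_trans[OF card_Un_le add_mono]) (metis card_image_le card_lessThan finite_lessThan)+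
  finally have m2: "m \<le> 2 * n" using a(1) by (simp add: P_def)
  \<comment> \<open>The bound on \<open>bm_gamma\<close> starts at dimension 1, so \<open>Z\<close>
    must be nontrivial.\<close>
  have "f 0 \<noteq> 0" using pos[of 0] n by auto
  moreover have "f 0 \<in> Z" unfolding Z_def using n by (intro span_base) auto
  ultimately have m1: "m \<ge> 1"
  proof (cases "m = 0")
    case True
    obtain B where B: "B \<subseteq> Z" "independent B" "Z \<subseteq> span B" "card B = dim Z"
      using basis_exists by blast
    have "finite B"
      using B(1,2) independent_span_bound[of "f ` {..<n} \<union> x ` {..<P a}" B] by (simp add: Z_def)
    then have "Z \<subseteq> {0}" using B(3,4) True by (simp add: m_def)
    then show ?thesis using \<open>f 0 \<noteq> 0\<close> \<open>f 0 \<in> Z\<close> by auto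
  qed simp
  obtain \<psi> :: "nat \<Rightarrow> 'a \<Rightarrow> real" where \<psi>: "\<And>p. linear (\<psi> p)"
    "\<And>z. z \<in> Z \<Longrightarrow> (norm z)\<^sup>2 \<le> (\<Sum>p<2 * n. (\<psi> p z)\<^sup>2)"
    "\<And>z. z \<in> Z \<Longrightarrow> (\<Sum>p<2 * n. (\<psi> p z)\<^sup>2) \<le> (\<gamma> * norm z)\<^sup>2"
    using bm_gamma_functionals[OF Zdim m2 bm[OF m1 m2]] by blast
  have blk_le: "blk j \<le> a" if "j < n" for j
  proof -
    have "(2::nat) ^ blk j < 2 ^ (a + 1)" using blk(1)[of j] that a(2) by linarith
    then show ?thesis using power_less_imp_less_exp[of "2::nat" "blk j" "a + 1"] by simp
  qed
  have "greedy_error f n ^ n = (\<Prod>i<n. greedy_error f n)" by simp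
  also have "\<dots> \<le> (\<Prod>i<n. infdist (f i) (span (f ` {..<i})))"
    using True greedy_error_le_infdist[OF f] n by (intro prod_mono) auto
  also have "\<dots> \<le> (\<gamma> * sqrt (real (Suc a))) ^ n * (\<Prod>j<n. e (blk j))"
  proof (rule prod_infdist_span_le[OF \<psi>(1) _ \<psi>(2,3) \<gamma> _ _ pos _ approx])
    show "subspace Z" by (simp add: Z_def)
    show "f i \<in> Z" if "i < n" for i unfolding Z_def using that by (intro span_base) auto
    show "e k > 0" for k using c by (simp add: e_def)
    show "P (blk j) \<le> j" for j using blk(1)[of j] by (simp add: P_def)
  qed (use blk_le in auto)
  also have "\<dots> \<le> (\<gamma> * sqrt (log 2 (2 * real n))) ^ n * (c * (16 powr s * real n powr (- s))) ^ n"
  proof (rule mult_mono)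
    have "real (2 ^ Suc a) \<le> real (2 * n)" using a(1) by (subst of_nat_le_iff) simp
    then have "real (Suc a) \<le> log 2 (2 * real n)"
      by (intro le_log_of_power) auto
    then show "(\<gamma> * sqrt (real (Suc a))) ^ n \<le> (\<gamma> * sqrt (log 2 (2 * real n))) ^ n"
      using \<gamma> by (intro power_mono mult_left_mono) auto
    \<comment> \<open>With \<open>blk j = l + 1\<close>, the block ends before
      \<open>2 ^ (l + 2) = 4 * 2 ^ l\<close>, while \<open>e\<close> uses width index
      \<open>2 ^ l\<close>; this costs the factor 4.\<close>
    have "e (blk j) \<le> c * (4 / real (Suc j)) powr s" for j
    proof (cases "blk j")
      case 0
      then have "j = 0" using blk(2)[of j] by simp
      then show ?thesis using 0 c s by (simp add: e_def ge_one_powr_ge_zero)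
    next
      case (Suc l)
      have "Suc j < 4 * 2 ^ l" using blk(2)[of j] Suc by simp
      then have "real (Suc j) < 4 * 2 ^ l"
        using of_nat_less_iff[of "Suc j" "4 * 2 ^ l", where 'a = real] by simp
      then have "1 / 2 ^ l \<le> 4 / real (Suc j)" by (simp add: field_simps)
      then have "(1 / 2 ^ l) powr s \<le> (4 / real (Suc j)) powr s"
        using s by (intro powr_mono2) auto
      moreover have "(1 / 2 ^ l) powr s = (2 ^ l) powr (- s)"
        by (simp add: powr_divide powr_minus_divide)
      ultimately show ?thesis using Suc c by (simp add: e_def)
    qed
    then have "(\<Prod>j<n. e (blk j)) \<le> (\<Prod>j<n. c * (4 / real (Suc j)) powr s)"
      using c by (intro prod_mono) (auto simp: e_def)
    also have "\<dots> \<le> (c * (16 powr s * real n powr (- s))) ^ n"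
      using s c n by (intro prod_powr_le) auto
    finally show "(\<Prod>j<n. e (blk j)) \<le> (c * (16 powr s * real n powr (- s))) ^ n" .
    have "log 2 (2 * real n) \<ge> 0" using n by simp
    then show "0 \<le> (\<gamma> * sqrt (log 2 (2 * real n))) ^ n" using \<gamma> by simp
    show "0 \<le> (\<Prod>j<n. e (blk j))" using c by (intro prod_nonneg) (auto simp: e_def)
  qed
  finally have "greedy_error f n ^ n \<le> (\<gamma> * sqrt (log 2 (2 * real n)) * (c * (16 powr s * real n powr (- s)))) ^ n"
    by (simp only: power_mult_distrib)
  then show ?thesis
    using n \<gamma> c by (subst (asm) power_mono_iff) (auto simp: less_imp_le[OF True])
qed

theorem theorem3p2:
  fixes K :: "'a::banach set"
    and f :: "nat \<Rightarrow> 'a"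
    and C0 C1 \<mu> s :: real
  assumes "compact K" and "K \<noteq> {}"
    and "C0 > 0" and "C1 > 0"
    and "0 \<le> \<mu>" and "\<mu> \<le> 1 / 2" and "s > \<mu>"
    and "\<And>n::nat. kolmogorov_width K n \<le> C0 * real (max 1 n) powr (- s)"
    and "\<And>n::nat. n \<ge> 1 \<Longrightarrow> bm_gamma TYPE('a) n \<le> ennreal (C1 * real n powr \<mu>)"
    and "greedy_sequence K f"
  shows "\<forall>n::nat\<ge>2. greedy_error f n
           \<le> C0 * C1 * 2 powr \<mu> * 16 powr s * sqrt (log 2 (2 * real n)) * real n powr (- s + \<mu>)"
proof (intro allI impI)
  fix n :: nat assume n: "n \<ge> 2"
  define R where "R = C0 * C1 * 2 powr \<mu> * 16 powr s * sqrt (log 2 (2 * real n)) * real n powr (- s + \<mu>)"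
  \<comment> \<open>Both constants are inflated by \<open>t > 1\<close> to make the bounds strict.
    The loss is \<open>t * t = 1 / z\<close>, which disappears as \<open>z\<close> tends to
    1.\<close>
  have "z * greedy_error f n \<le> R" if z: "0 < z" "z < 1" for z :: real
  proof -
    define t where "t = 1 / sqrt z"
    have t: "t > 1" "t * t = 1 / z" using z by (auto simp: t_def)
    have "greedy_error f n \<le> (t * (C1 * real (2 * n) powr \<mu>)) * sqrt (log 2 (2 * real n)) *
        ((t * C0) * (16 powr s * real n powr (- s)))"
    proof (rule greedy_error_le[OF compact_imp_bounded assms(10)])
      show "kolmogorov_width K m < t * C0 * real (max 1 m) powr (- s)" for m
        by (rule le_less_trans[OF assms(8)]) (use t assms(3) in auto)
      \<comment> \<open>The spaces involved have dimension up to \<open>2 * n\<close>, which is the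
        source of the factor \<open>2 powr \<mu>\<close>.\<close>
      show "bm_gamma TYPE('a) m < ennreal (t * (C1 * real (2 * n) powr \<mu>))"
        if m: "1 \<le> m" "m \<le> 2 * n" for m
      proof (rule le_less_trans[OF assms(9)[OF m(1)]], rule ennreal_lessI)
        have "C1 * real m powr \<mu> \<le> C1 * real (2 * n) powr \<mu>"
          using m assms(4,5) by (intro mult_left_mono powr_mono2) auto
        also have "\<dots> < t * (C1 * real (2 * n) powr \<mu>)" using t(1) n assms(4) by simp
        finally show "C1 * real m powr \<mu> < t * (C1 * real (2 * n) powr \<mu>)" .
      qed (use t n assms(4) in auto)
    qed (use assms t n in auto)
    also have "\<dots> = (t * t) * R"
      unfolding R_def powr_add by (simp add: powr_mult mult_ac)
    finally show ?thesis using z by (simp add: t(2) field_simps)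
  qed
  then show "greedy_error f n \<le> R" by (rule field_le_mult_one_interval)
qed

end
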